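(* Let $L$ be a finite lattice with $1\in J(L)$, let $\tilde L$ be as in the context, and let $T'$ be a left-semicontinuous t-norm on $\tilde L$. If the restriction $T'|_L$ of $T'$ to $L\times L$ is a t-norm on $L$, then $T'|_L$ is left-continuous.
   Context: For a lattice $L$ with bottom $0$ and top $1$: an atom is an element covering $0$; $A(L)$ is the set of atoms; $J(L)$ the set of non-zero join-irreducible elements ($q\ne0$ with $q=x\vee y\Rightarrow q\in\{x,y\}$); $H(L)=J(L)\setminus A(L)$. $\tilde L$ is obtained from the finite lattice $L$ by adding, for each $p\in H(L)$, a new distinct element $w_p$ with $0\prec w_p\prec p$ (so $w_p\le x$ for $x\in L$ iff $p\le x$); $\tilde L$ is a finite atomistic lattice containing $L$ as a sublattice with the same $0$ and $1$. A t-norm on a bounded lattice is a binary operation that is monotone in each argument, commutative, associative, with neutral element $1$. A t-norm $T$ on a complete lattice $M$ is left-semicontinuous if $T(a,\bigvee S)=\bigvee_{x\in S}T(a,x)$ for every $a\in M$ and $S\subseteq M$ with $\bigvee S\ne1$, and left-continuous if this holds for all $S\subseteq M$. *)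

theory Defs
  imports Main
begin

definition covers :: "'a::order \<Rightarrow> 'a \<Rightarrow> bool"  (infix "\<lessdot>" 50)
  where "x \<lessdot> y \<longleftrightarrow> x < y \<and> \<not> (\<exists>z. x < z \<and> z < y)"

definition atoms :: "'a::bounded_lattice set"
  where "atoms = {a. bot \<lessdot> a}"

definition join_irreducibles :: "'a::bounded_lattice set"
  where "join_irreducibles = {q. q \<noteq> bot \<and> (\<forall>x y. q = sup x y \<longrightarrow> q = x \<or> q = y)}"

definition nonatomic_irreducibles :: "'a::bounded_lattice set"
  where "nonatomic_irreducibles = join_irreducibles - atoms"


text \<open>
  The extension of a lattice \<open>L\<close>, written \<open>L\<close> with a tilde on paper: \<open>Inl x\<close> stands for the
  element \<open>x\<close> of \<open>L\<close>, and \<open>Inr p\<close> for the new element \<open>w\<^sub>p\<close> placed between \<open>0\<close> and \<open>p\<close>.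
\<close>

typedef (overloaded) 'a tilde =
  "range Inl \<union> Inr ` nonatomic_irreducibles :: ('a::bounded_lattice + 'a) set"
  by blast

definition old :: "'a::bounded_lattice \<Rightarrow> 'a tilde"
  where "old x = Abs_tilde (Inl x)"

text \<open>Only meaningful for \<open>p \<in> nonatomic_irreducibles\<close>.\<close>

definition new :: "'a::bounded_lattice \<Rightarrow> 'a tilde"
  where "new p = Abs_tilde (Inr p)"

lemma Rep_old [simp]: "Rep_tilde (old x) = Inl x"
  unfolding old_def by (rule Abs_tilde_inverse) simp

lemma Rep_new [simp]: "p \<in> nonatomic_irreducibles \<Longrightarrow> Rep_tilde (new p) = Inr p"
  unfolding new_def by (rule Abs_tilde_inverse) simp

lemma tilde_cases [case_names old new, cases type: tilde]:
  obtains (old) x where "s = old x"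
  | (new) p where "s = new p" "p \<in> nonatomic_irreducibles"
proof -
  have "Rep_tilde s \<in> range Inl \<union> Inr ` nonatomic_irreducibles" by (rule Rep_tilde)
  then consider x where "Rep_tilde s = Inl x"
    | p where "Rep_tilde s = Inr p" "p \<in> nonatomic_irreducibles" by blast
  then show thesis
    by cases (metis Rep_tilde_inverse old_def that(1), metis Rep_tilde_inverse new_def that(2))
qed

lemma old_inject [simp]: "old x = old y \<longleftrightarrow> x = y"
  by (metis Rep_old sum.inject(1))

lemma new_inject [simp]:
  "\<lbrakk>p \<in> nonatomic_irreducibles; q \<in> nonatomic_irreducibles\<rbrakk> \<Longrightarrow> new p = new q \<longleftrightarrow> p = q"
  by (metis Rep_new sum.inject(2))

lemma old_neq_new [simp]:
  assumes "p \<in> nonatomic_irreducibles"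
  shows "old x \<noteq> new p" "new p \<noteq> old x"
  using assms by (metis Rep_new Rep_old sum.distinct(1))+

lemma irreducible_neq_bot [simp]: "p \<in> nonatomic_irreducibles \<Longrightarrow> p \<noteq> bot"
  by (simp add: nonatomic_irreducibles_def join_irreducibles_def)

instantiation tilde :: (bounded_lattice) order
begin

definition less_eq_tilde :: "'a tilde \<Rightarrow> 'a tilde \<Rightarrow> bool"
  where "s \<le> t \<longleftrightarrow>
    (case (Rep_tilde s, Rep_tilde t) of
      (Inl x, Inl y) \<Rightarrow> x \<le> y
    | (Inl x, Inr q) \<Rightarrow> x = bot
    | (Inr p, Inl y) \<Rightarrow> p \<le> y
    | (Inr p, Inr q) \<Rightarrow> p = q)"

definition less_tilde :: "'a tilde \<Rightarrow> 'a tilde \<Rightarrow> bool"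
  where "(s :: 'a tilde) < t \<longleftrightarrow> s \<le> t \<and> \<not> t \<le> s"

lemma tilde_le [simp]:
  "old x \<le> old y \<longleftrightarrow> x \<le> y"
  "q \<in> nonatomic_irreducibles \<Longrightarrow> old x \<le> new q \<longleftrightarrow> x = bot"
  "p \<in> nonatomic_irreducibles \<Longrightarrow> new p \<le> old y \<longleftrightarrow> p \<le> y"
  "\<lbrakk>p \<in> nonatomic_irreducibles; q \<in> nonatomic_irreducibles\<rbrakk> \<Longrightarrow> new p \<le> new q \<longleftrightarrow> p = q"
  by (simp_all add: less_eq_tilde_def)

instance
proof
  fix s t u :: "'a tilde"
  show "s < t \<longleftrightarrow> s \<le> t \<and> \<not> t \<le> s" by (rule less_tilde_def)
  show "s \<le> s" by (cases s) auto
  show "s \<le> u" if "s \<le> t" "t \<le> u"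
    using that by (cases s; cases t; cases u) (auto simp: bot_unique)
  show "s = t" if "s \<le> t" "t \<le> s"
    using that by (cases s; cases t) (auto simp: bot_unique)
qed

end

lemma finite_tilde: "finite (UNIV :: 'a::{finite,bounded_lattice} tilde set)"
proof -
  have "UNIV = range old \<union> new ` (UNIV :: 'a set)"
    using tilde_cases by blast
  then show ?thesis by (metis finite finite_UnI finite_imageI)
qed

instance tilde :: ("{finite,bounded_lattice}") finite
  by standard (rule finite_tilde)


text \<open>The least element of \<open>L\<close> above a given element of the extension.\<close>

definition hull :: "'a::bounded_lattice tilde \<Rightarrow> 'a"
  where "hull s = (case Rep_tilde s of Inl x \<Rightarrow> x | Inr p \<Rightarrow> p)"

lemma hull_simps [simp]:
  "hull (old x) = x"
  "p \<in> nonatomic_irreducibles \<Longrightarrow> hull (new p) = p"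
  by (simp_all add: hull_def)

lemma le_old_iff: "s \<le> old y \<longleftrightarrow> hull s \<le> y"
  by (cases s) auto

text \<open>
  The lattice operations are determined by the order. A set without a greatest element has the
  same upper bounds as its hull, except that the empty set is also bounded by the new elements.
\<close>

instantiation tilde :: (complete_lattice) complete_lattice
begin

definition Sup_tilde :: "'a tilde set \<Rightarrow> 'a tilde"
  where "Sup (S :: 'a tilde set) = (if \<exists>s\<in>S. \<forall>t\<in>S. t \<le> s then THE s. s \<in> S \<and> (\<forall>t\<in>S. t \<le> s)
                  else old (SUP s\<in>S. hull s))"

definition Inf_tilde :: "'a tilde set \<Rightarrow> 'a tilde"
  where "Inf (S :: 'a tilde set) = Sup {l. \<forall>s\<in>S. l \<le> s}"

definition sup_tilde :: "'a tilde \<Rightarrow> 'a tilde \<Rightarrow> 'a tilde"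
  where "sup s (t :: 'a tilde) = Sup {s, t}"

definition inf_tilde :: "'a tilde \<Rightarrow> 'a tilde \<Rightarrow> 'a tilde"
  where "inf s (t :: 'a tilde) = Inf {s, t}"

definition bot_tilde :: "'a tilde"
  where "(bot :: 'a tilde) = old bot"

definition top_tilde :: "'a tilde"
  where "(top :: 'a tilde) = old top"

lemma Sup_tilde_greatest:
  fixes s :: "'a tilde"
  assumes "s \<in> S" "\<And>t. t \<in> S \<Longrightarrow> t \<le> s"
  shows "Sup S = s"
proof -
  have "(THE s. s \<in> S \<and> (\<forall>t\<in>S. t \<le> s)) = s"
    using assms by (intro the_equality) (auto intro: order.antisym)
  then show ?thesis using assms by (auto simp: Sup_tilde_def)
qed

lemma Sup_tilde_no_greatest:
  fixes S :: "'a tilde set"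
  assumes "\<not> (\<exists>s\<in>S. \<forall>t\<in>S. t \<le> s)"
  shows "Sup S = old (SUP s\<in>S. hull s)"
  unfolding Sup_tilde_def by (rule if_not_P) (rule assms)

lemma Sup_tilde_lub:
  fixes S :: "'a tilde set" and u :: "'a tilde"
  shows "Sup S \<le> u \<longleftrightarrow> (\<forall>s\<in>S. s \<le> u)"
proof (cases "\<exists>s\<in>S. \<forall>t\<in>S. t \<le> s")
  case True
  then obtain m where m: "m \<in> S" "\<And>t. t \<in> S \<Longrightarrow> t \<le> m" by blast
  then have "Sup S = m" by (rule Sup_tilde_greatest)
  with m show ?thesis by (metis order_trans)
next
  case False
  note Sup = Sup_tilde_no_greatest [OF False]
  show ?thesis
  proof (cases u)
    case (old y)
    then show ?thesis by (simp add: Sup SUP_le_iff le_old_iff)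
  next
    case (new p)
    have S: "S = {}" if *: "\<forall>s\<in>S. s \<le> new p"
    proof (rule ccontr)
      assume "S \<noteq> {}"
      have "new p \<notin> S" using False * by blast
      have "s = old bot" if "s \<in> S" for s
        using that * \<open>new p \<notin> S\<close> new by (cases s) auto
      then show False using False \<open>S \<noteq> {}\<close> by (metis order_refl ex_in_conv)
    qed
    have "s \<le> new p" if "(SUP s\<in>S. hull s) = bot" "s \<in> S" for s
    proof -
      have "hull s = bot" using that by (metis SUP_bot_conv(1))
      then show ?thesis using new by (cases s) auto
    qed
    then show ?thesis using S new by (auto simp: Sup)
  qed
qed

instance
proof
  fix s t u :: "'a tilde" and S :: "'a tilde set"
  show Inf_lower: "Inf S \<le> s" if "s \<in> S" for s and S :: "'a tilde set"
    using that by (auto simp: Inf_tilde_def Sup_tilde_lub)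
  show Inf_greatest: "u \<le> Inf S" if "\<And>s. s \<in> S \<Longrightarrow> u \<le> s" for u and S :: "'a tilde set"
    using that Sup_tilde_lub [of "{l. \<forall>s\<in>S. l \<le> s}"] by (auto simp: Inf_tilde_def)
  show "s \<le> Sup S" if "s \<in> S" using that Sup_tilde_lub by blast
  show "Sup S \<le> u" if "\<And>s. s \<in> S \<Longrightarrow> s \<le> u" using that Sup_tilde_lub by blast
  show "inf s t \<le> s" "inf s t \<le> t" by (auto simp: inf_tilde_def intro: Inf_lower)
  show "s \<le> inf t u" if "s \<le> t" "s \<le> u"
    using that by (auto simp: inf_tilde_def intro: Inf_greatest)
  show "s \<le> sup s t" "t \<le> sup s t"
    using Sup_tilde_lub [of "{s, t}" "Sup {s, t}"] by (simp_all add: sup_tilde_def)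
  show "sup t u \<le> s" if "t \<le> s" "u \<le> s" using that by (simp add: sup_tilde_def Sup_tilde_lub)
  show "Inf {} = (top :: 'a tilde)"
    by (rule order.antisym) (simp add: top_tilde_def le_old_iff, rule Inf_greatest, simp)
  show "Sup {} = (bot :: 'a tilde)"
    by (simp add: Sup_tilde_no_greatest bot_tilde_def)
qed

end


text \<open>The defining properties of the extension.\<close>

lemma bot_covers_new: "p \<in> nonatomic_irreducibles \<Longrightarrow> bot \<lessdot> new (p :: 'a::complete_lattice)"
  unfolding covers_def
proof (intro conjI notI)
  assume p: "p \<in> nonatomic_irreducibles"
  then show "bot < new p" by (simp add: less_tilde_def bot_tilde_def bot_unique)
  assume "\<exists>z. bot < z \<and> z < new p"
  then obtain z where z: "bot < z" "z < new p" by blast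
  then show False using p by (cases z) (auto simp: less_tilde_def bot_tilde_def bot_unique)
qed

lemma new_covered: "p \<in> nonatomic_irreducibles \<Longrightarrow> new p \<lessdot> old p"
  unfolding covers_def
proof (intro conjI notI)
  assume p: "p \<in> nonatomic_irreducibles"
  then show "new p < old p" by (simp add: less_tilde_def)
  assume "\<exists>z. new p < z \<and> z < old p"
  then obtain z where z: "new p < z" "z < old p" by blast
  then show False using p by (cases z) (auto simp: less_tilde_def)
qed

lemma old_sup: "old (sup x y) = sup (old x) (old (y :: 'a::complete_lattice))"
proof (rule order.antisym)
  have "old x \<le> u \<Longrightarrow> old y \<le> u \<Longrightarrow> old (sup x y) \<le> u" for u
    by (cases u) auto
  then show "old (sup x y) \<le> sup (old x) (old y)" by simp
qed simp

lemma old_inf: "old (inf x y) = inf (old x) (old (y :: 'a::complete_lattice))"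
proof (rule order.antisym)
  have "u \<le> old x \<Longrightarrow> u \<le> old y \<Longrightarrow> u \<le> old (inf x y)" for u
    by (cases u) auto
  then show "inf (old x) (old y) \<le> old (inf x y)" by simp
qed simp

lemma old_bot_top:
  "old bot = (bot :: 'a::complete_lattice tilde)"
  "old top = (top :: 'a::complete_lattice tilde)"
  by (simp_all add: bot_tilde_def top_tilde_def)

definition t_norm :: "('a::bounded_lattice \<Rightarrow> 'a \<Rightarrow> 'a) \<Rightarrow> bool"
  where "t_norm T \<longleftrightarrow>
    (\<forall>x y z. x \<le> y \<longrightarrow> T x z \<le> T y z \<and> T z x \<le> T z y) \<and>
    (\<forall>x y. T x y = T y x) \<and>
    (\<forall>x y z. T (T x y) z = T x (T y z)) \<and>
    (\<forall>x. T x top = x \<and> T top x = x)"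

definition left_semicontinuous :: "('a::complete_lattice \<Rightarrow> 'a \<Rightarrow> 'a) \<Rightarrow> bool"
  where "left_semicontinuous T \<longleftrightarrow>
    (\<forall>a S. Sup S \<noteq> top \<longrightarrow> T a (Sup S) = (SUP x\<in>S. T a x))"

definition left_continuous :: "('a::complete_lattice \<Rightarrow> 'a \<Rightarrow> 'a) \<Rightarrow> bool"
  where "left_continuous T \<longleftrightarrow> (\<forall>a S. T a (Sup S) = (SUP x\<in>S. T a x))"

end

theory Submission
  imports Defs
begin

text \<open>
  Since \<open>L\<close> is closed under arbitrary joins in its extension, left-semicontinuity is inherited by
  the restriction. The only remaining joins are those equal to \<open>1\<close>; as \<open>1\<close> is join-irreducible and
  \<open>L\<close> is finite, such a join contains \<open>1\<close> as a member, and monotonicity settles this case.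
\<close>

lemma old_Sup: "old (Sup S) = (SUP x\<in>S. old (x :: 'a::complete_lattice))"
proof (rule order.antisym)
  have "old (Sup S) \<le> u" if "\<And>x. x \<in> S \<Longrightarrow> old x \<le> u" for u
    using that
  proof (cases u)
    \<comment> \<open>The only old element below \<open>new p\<close> is \<open>bot\<close>, so this
      upper bound forces \<open>Sup S = bot\<close>.\<close>
    case (new p)
    then have "\<forall>x\<in>S. x = bot" using that by simp
    then show ?thesis using new by (simp add: Sup_bot_conv)
  qed (simp add: Sup_le_iff)
  then show "old (Sup S) \<le> (SUP x\<in>S. old x)" by (simp add: SUP_upper)
qed (simp add: SUP_le_iff Sup_upper)

text \<open>The empty join \<open>bot\<close> is not join-irreducible. Otherwise split off one
  element: the join is that element or the join of the rest, which is then itself join-irreducible,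
  so induction applies.\<close>

lemma join_irreducible_Sup_mem:
  fixes S :: "'a::complete_lattice set"
  assumes "finite S" and "Sup S \<in> join_irreducibles"
  shows "Sup S \<in> S"
  using assms
proof (induction S rule: finite_induct)
  case empty
  then show ?case by (simp add: join_irreducibles_def)
next
  case (insert x S)
  then have "Sup (insert x S) = x \<or> Sup (insert x S) = Sup S"
    by (simp add: join_irreducibles_def)
  then show ?case using insert by auto
qed

theorem theorem6p7:
  fixes T' :: "'a::{finite,complete_lattice} tilde \<Rightarrow> 'a tilde \<Rightarrow> 'a tilde"
    and T :: "'a \<Rightarrow> 'a \<Rightarrow> 'a"
  assumes "(top :: 'a) \<in> join_irreducibles"
    and "t_norm T'"
    and "left_semicontinuous T'"
    and "\<And>x y. old (T x y) = T' (old x) (old y)"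
    and "t_norm T"
  shows "left_continuous T"
  unfolding left_continuous_def
proof (intro allI)
  fix a :: 'a and S :: "'a set"
  show "T a (Sup S) = (SUP x\<in>S. T a x)"
  proof (cases "Sup S = top")
    case True
    then have "top \<in> S"
      using assms(1) join_irreducible_Sup_mem [of S] by simp
    moreover have "T a x \<le> T a top" for x
      using \<open>t_norm T\<close> top_greatest unfolding t_norm_def by blast
    ultimately have "(SUP x\<in>S. T a x) = T a top"
      by (intro order.antisym SUP_least SUP_upper)
    then show ?thesis by (simp add: True)
  next
    case False
    \<comment> \<open>Left-semicontinuity of \<open>T'\<close> needs the join in the extension to
      differ from \<open>top\<close>; \<open>old\<close> is injective and preserves
      \<open>top\<close> and joins.\<close>
    then have "(SUP x\<in>S. old x) \<noteq> top"
      by (metis old_Sup old_bot_top(2) old_inject)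
    then have "T' (old a) (SUP x\<in>S. old x) = (SUP x\<in>S. T' (old a) (old x))"
      using \<open>left_semicontinuous T'\<close> by (simp add: left_semicontinuous_def image_image)
    then have "old (T a (Sup S)) = old (SUP x\<in>S. T a x)"
      by (simp add: assms(4) old_Sup image_image)
    then show ?thesis by simp
  qed
qed

end
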